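(* Let $(A,\mu,r)$ be a coboundary $\epsilon$-bialgebra, with $r=\sum_i u_i\otimes v_i\in A\otimes A$ (a finite sum), and write $ab=\mu(a\otimes b)$. (1) The linear map $\mathfrak R:A\to A$, defined for all $a\in A$ by $\mathfrak R(a):=\sum_i u_iav_i$, is a weak Rota-Baxter operator (of weight zero) for $A$. (2) For $a,b\in A$, let $a\succ b:=\mathfrak R(a)b=\sum_i u_iav_ib$ and $a\prec b:=a\mathfrak R(b)=\sum_i au_ibv_i$. Then $(A,\prec,\succ)$ is an inner-associative $A_3$-dendriform algebra.
   Context: All structures are over a commutative ring $R$ in which $2$ is invertible; $\otimes=\otimes_R$. Algebras are $R$-modules with bilinear products and are not assumed unital. Let $(A,\mu)$ be an associative algebra and $r=\sum_i u_i\otimes v_i\in A\otimes A$. Put $$\mathrm{AYB}(r):=r_{13}r_{12}-r_{12}r_{23}+r_{23}r_{13}=\sum_{i,j}\bigl(u_iu_j\otimes v_j\otimes v_i-u_i\otimes v_iu_j\otimes v_j+u_j\otimes u_i\otimes v_iv_j\bigr)\in A\otimes A\otimes A .$$ $(A,\mu,r)$ is called a coboundary $\epsilon$-bialgebra if $\mathrm{AYB}(r)$ is invariant, i.e. $a\cdot \mathrm{AYB}(r)=\mathrm{AYB}(r)\cdot a$ for all $a\in A$, where $a\cdot(x\otimes y\otimes z)=ax\otimes y\otimes z$ and $(x\otimes y\otimes z)\cdot a=x\otimes y\otimes za$. (This is known to be equivalent to $(A,\mu,\Delta_r)$ being an $\epsilon$-bialgebra, where $\Delta_r(a)=r\cdot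 a-a\cdot r$; an $\epsilon$-bialgebra is a triple $(A,\mu,\Delta)$ with $\mu$ associative, $\Delta:A\to A\otimes A$ coassociative and $\Delta(ab)=a\cdot\Delta(b)+\Delta(a)\cdot b$, the dots denoting the natural left and right actions.) A weak Rota-Baxter operator (of weight zero) of an algebra $A$ is a linear map $\mathfrak R:A\to A$ such that, for all $a,b\in A$, the element $\mathfrak R(a\mathfrak R(b)+\mathfrak R(a)b)-\mathfrak R(a)\mathfrak R(b)$ commutes with every element of $A$. An algebra $(A,\prec,\succ)$ with two products is an $A_3$-dendriform algebra if, with $a\star b:=a\prec b+a\succ b$, for all $a,b,c\in A$, $$a\succ(b\succ c)-(c\prec a)\prec b+c\prec(a\star b)=(a\star b)\succ c-b\succ(c\prec a)+(b\succ c)\prec a .$$ It is inner-associative if $(a\succ b)\prec c=a\succ(b\prec c)$ for all $a,b,c\in A$. *)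

theory Defs
  imports Complex_Main "HOL-Library.Poly_Mapping" "HOL-Library.Set_Algebras"
begin

section \<open>Algebras over a commutative ring\<close>

text \<open>
  The ground ring is a type of class \<open>comm_ring_1\<close>; a module over it is given by its scalar
  multiplication, as in \<^theory>\<open>HOL.Modules\<close>. A product \<open>A \<otimes> A \<rightarrow> A\<close> is a curried bilinear map.
\<close>

definition bilinear_product ::
    "('r::comm_ring_1 \<Rightarrow> 'a::ab_group_add \<Rightarrow> 'a) \<Rightarrow> ('a \<Rightarrow> 'a \<Rightarrow> 'a) \<Rightarrow> bool"
  where "bilinear_product scale m \<longleftrightarrow>
    (\<forall>a. module_hom scale scale (\<lambda>b. m a b)) \<and> (\<forall>b. module_hom scale scale (\<lambda>a. m a b))"

definition associative_algebra ::
    "('r::comm_ring_1 \<Rightarrow> 'a::ab_group_add \<Rightarrow> 'a) \<Rightarrow> ('a \<Rightarrow> 'a \<Rightarrow> 'a) \<Rightarrow> bool"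
  where "associative_algebra scale m \<longleftrightarrow>
    module scale \<and> bilinear_product scale m \<and> (\<forall>a b c. m (m a b) c = m a (m b c))"

definition weak_rota_baxter ::
    "('r::comm_ring_1 \<Rightarrow> 'a::ab_group_add \<Rightarrow> 'a) \<Rightarrow> ('a \<Rightarrow> 'a \<Rightarrow> 'a) \<Rightarrow> ('a \<Rightarrow> 'a) \<Rightarrow> bool"
  where "weak_rota_baxter scale m \<RR> \<longleftrightarrow>
    module_hom scale scale \<RR> \<and>
    (\<forall>a b c. let w = \<RR> (m a (\<RR> b) + m (\<RR> a) b) - m (\<RR> a) (\<RR> b) in m w c = m c w)"

definition A3_dendriform ::
    "('r::comm_ring_1 \<Rightarrow> 'a::ab_group_add \<Rightarrow> 'a) \<Rightarrow> ('a \<Rightarrow> 'a \<Rightarrow> 'a) \<Rightarrow> ('a \<Rightarrow> 'a \<Rightarrow> 'a) \<Rightarrow> bool"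
  where "A3_dendriform scale prec succ \<longleftrightarrow>
    module scale \<and> bilinear_product scale prec \<and> bilinear_product scale succ \<and>
    (\<forall>a b c. let star = (\<lambda>x y. prec x y + succ x y) in
       succ a (succ b c) - prec (prec c a) b + prec c (star a b) =
       succ (star a b) c - succ b (prec c a) + prec (succ b c) a)"

definition inner_associative ::
    "('a \<Rightarrow> 'a \<Rightarrow> 'a) \<Rightarrow> ('a \<Rightarrow> 'a \<Rightarrow> 'a) \<Rightarrow> bool"
  where "inner_associative prec succ \<longleftrightarrow> (\<forall>a b c. prec (succ a b) c = succ a (prec b c))"


section \<open>Free modules\<close>

text \<open>
  The free module on \<open>'x\<close> consists of the finitely supported functions \<open>'x \<Rightarrow>\<^sub>0 'r\<close>, with basis
  \<open>basis x\<close>; \<open>free_ext s f\<close> is the linear extension of \<open>f\<close> to a module with scalar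
  multiplication \<open>s\<close>.
\<close>

definition free_scale :: "'r::comm_ring_1 \<Rightarrow> ('x \<Rightarrow>\<^sub>0 'r) \<Rightarrow> ('x \<Rightarrow>\<^sub>0 'r)"
  where "free_scale c p = Poly_Mapping.map ((*) c) p"

abbreviation basis :: "'x \<Rightarrow> ('x \<Rightarrow>\<^sub>0 'r::comm_ring_1)"
  where "basis x \<equiv> Poly_Mapping.single x 1"

definition free_ext ::
    "('r::comm_ring_1 \<Rightarrow> 'b::ab_group_add \<Rightarrow> 'b) \<Rightarrow> ('x \<Rightarrow> 'b) \<Rightarrow> ('x \<Rightarrow>\<^sub>0 'r) \<Rightarrow> 'b"
  where "free_ext s f p = (\<Sum>x\<in>Poly_Mapping.keys p. s (Poly_Mapping.lookup p x) (f x))"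

lemma lookup_free_scale [simp]:
  "Poly_Mapping.lookup (free_scale c p) x = c * Poly_Mapping.lookup p x"
  by (simp add: free_scale_def map.rep_eq when_def)

lemma module_free_scale: "module free_scale"
  by standard (auto intro!: poly_mapping_eqI simp: lookup_add algebra_simps)

lemma free_ext_superset:
  assumes "module s" "finite X" "Poly_Mapping.keys p \<subseteq> X"
  shows "free_ext s f p = (\<Sum>x\<in>X. s (Poly_Mapping.lookup p x) (f x))"
  unfolding free_ext_def
  by (rule sum.mono_neutral_left)
     (use assms in \<open>auto simp: in_keys_iff module.scale_zero_left\<close>)

lemma module_hom_free_ext:
  assumes s: "module s"
  shows "module_hom free_scale s (free_ext s f)"
proof -
  interpret s: module s by fact
  have add: "free_ext s f (p + q) = free_ext s f p + free_ext s f q" for p q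
  proof -
    let ?X = "Poly_Mapping.keys p \<union> Poly_Mapping.keys q"
    have "Poly_Mapping.keys (p + q) \<subseteq> ?X" by (rule Poly_Mapping.keys_add)
    then show ?thesis
      by (simp add: free_ext_superset[OF s, of ?X] lookup_add s.scale_left_distrib sum.distrib)
  qed
  have scale: "free_ext s f (free_scale c p) = s c (free_ext s f p)" for c p
  proof -
    have "Poly_Mapping.keys (free_scale c p) \<subseteq> Poly_Mapping.keys p"
      by (auto simp: in_keys_iff)
    then show ?thesis
      by (simp add: free_ext_superset[OF s, of "Poly_Mapping.keys p"] s.scale_sum_right)
  qed
  show ?thesis
    by (simp add: module_hom_iff s module_free_scale add scale)
qed

lemma free_ext_basis [simp]: "module s \<Longrightarrow> free_ext s f (basis x) = f x"
  by (simp add: free_ext_def module.scale_one)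


section \<open>Tensor powers\<close>

text \<open>
  \<open>A \<otimes> A\<close> and \<open>A \<otimes> A \<otimes> A\<close> are the quotients of the free modules on \<open>A \<times> A\<close> and
  \<open>A \<times> A \<times> A\<close> by the submodules generated by the multilinearity relations. Their elements are
  the cosets \<open>p +o tensor_rel2 scale\<close> and \<open>p +o tensor_rel3 scale\<close>; in particular the tensor
  \<open>\<Sum>i. u\<^sub>i \<otimes> v\<^sub>i\<close> is the coset of the formal sum \<open>\<Sum>i. basis (u\<^sub>i, v\<^sub>i)\<close>.
\<close>

definition tensor_gens2 ::
    "('r::comm_ring_1 \<Rightarrow> 'a::ab_group_add \<Rightarrow> 'a) \<Rightarrow> ('a \<times> 'a \<Rightarrow>\<^sub>0 'r) set"
  where "tensor_gens2 scale =
      {basis (x + x', y) - basis (x, y) - basis (x', y) | x x' y. True}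
    \<union> {basis (x, y + y') - basis (x, y) - basis (x, y') | x y y'. True}
    \<union> {basis (scale c x, y) - free_scale c (basis (x, y)) | c x y. True}
    \<union> {basis (x, scale c y) - free_scale c (basis (x, y)) | c x y. True}"

definition tensor_gens3 ::
    "('r::comm_ring_1 \<Rightarrow> 'a::ab_group_add \<Rightarrow> 'a) \<Rightarrow> ('a \<times> 'a \<times> 'a \<Rightarrow>\<^sub>0 'r) set"
  where "tensor_gens3 scale =
      {basis (x + x', y, z) - basis (x, y, z) - basis (x', y, z) | x x' y z. True}
    \<union> {basis (x, y + y', z) - basis (x, y, z) - basis (x, y', z) | x y y' z. True}
    \<union> {basis (x, y, z + z') - basis (x, y, z) - basis (x, y, z') | x y z z'. True}
    \<union> {basis (scale c x, y, z) - free_scale c (basis (x, y, z)) | c x y z. True}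
    \<union> {basis (x, scale c y, z) - free_scale c (basis (x, y, z)) | c x y z. True}
    \<union> {basis (x, y, scale c z) - free_scale c (basis (x, y, z)) | c x y z. True}"

definition tensor_rel2 ::
    "('r::comm_ring_1 \<Rightarrow> 'a::ab_group_add \<Rightarrow> 'a) \<Rightarrow> ('a \<times> 'a \<Rightarrow>\<^sub>0 'r) set"
  where "tensor_rel2 scale = module.span free_scale (tensor_gens2 scale)"

definition tensor_rel3 ::
    "('r::comm_ring_1 \<Rightarrow> 'a::ab_group_add \<Rightarrow> 'a) \<Rightarrow> ('a \<times> 'a \<times> 'a \<Rightarrow>\<^sub>0 'r) set"
  where "tensor_rel3 scale = module.span free_scale (tensor_gens3 scale)"

definition tensor2 ::
    "('r::comm_ring_1 \<Rightarrow> 'a::ab_group_add \<Rightarrow> 'a) \<Rightarrow> ('a \<times> 'a \<Rightarrow>\<^sub>0 'r) set set"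
  where "tensor2 scale = range (\<lambda>p. p +o tensor_rel2 scale)"

text \<open>
  \<open>induced N F\<close> is the map into a quotient by \<open>N\<close> that \<open>F\<close> induces on cosets; below it is only
  used where the result does not depend on the representative (see \<open>induced_coset\<close>).
\<close>

definition induced :: "'c::ab_group_add set \<Rightarrow> ('b \<Rightarrow> 'c) \<Rightarrow> 'b set \<Rightarrow> 'c set"
  where "induced N F t = (\<Union>p\<in>t. F p +o N)"

definition left_action ::
    "('r::comm_ring_1 \<Rightarrow> 'a::ab_group_add \<Rightarrow> 'a) \<Rightarrow> ('a \<Rightarrow> 'a \<Rightarrow> 'a) \<Rightarrow> 'a
      \<Rightarrow> ('a \<times> 'a \<times> 'a \<Rightarrow>\<^sub>0 'r) set \<Rightarrow> ('a \<times> 'a \<times> 'a \<Rightarrow>\<^sub>0 'r) set"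
  where "left_action scale m a =
    induced (tensor_rel3 scale) (free_ext free_scale (\<lambda>(x, y, z). basis (m a x, y, z)))"

definition right_action ::
    "('r::comm_ring_1 \<Rightarrow> 'a::ab_group_add \<Rightarrow> 'a) \<Rightarrow> ('a \<Rightarrow> 'a \<Rightarrow> 'a) \<Rightarrow> 'a
      \<Rightarrow> ('a \<times> 'a \<times> 'a \<Rightarrow>\<^sub>0 'r) set \<Rightarrow> ('a \<times> 'a \<times> 'a \<Rightarrow>\<^sub>0 'r) set"
  where "right_action scale m a =
    induced (tensor_rel3 scale) (free_ext free_scale (\<lambda>(x, y, z). basis (x, y, m z a)))"


section \<open>Coboundary epsilon-bialgebras\<close>

text \<open>
  \<open>AYB_term m (u\<^sub>i, v\<^sub>i) (u\<^sub>j, v\<^sub>j)\<close> is the \<open>(i, j)\<close> summand of \<open>AYB(r)\<close>, and \<open>AYB_free m\<close> its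
  bilinear extension to formal sums, evaluated on the diagonal.
\<close>

definition AYB_term ::
    "('a \<Rightarrow> 'a \<Rightarrow> 'a) \<Rightarrow> 'a \<times> 'a \<Rightarrow> 'a \<times> 'a \<Rightarrow> ('a \<times> 'a \<times> 'a \<Rightarrow>\<^sub>0 'r::comm_ring_1)"
  where "AYB_term m = (\<lambda>(u, v) (u', v').
    basis (m u u', v', v) - basis (u, m v u', v') + basis (u', u, m v v'))"

definition AYB_free ::
    "('a \<Rightarrow> 'a \<Rightarrow> 'a) \<Rightarrow> ('a \<times> 'a \<Rightarrow>\<^sub>0 'r::comm_ring_1) \<Rightarrow> ('a \<times> 'a \<times> 'a \<Rightarrow>\<^sub>0 'r)"
  where "AYB_free m p =
    free_ext free_scale (\<lambda>x. free_ext free_scale (\<lambda>y. AYB_term m x y) p) p"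

definition AYB ::
    "('r::comm_ring_1 \<Rightarrow> 'a::ab_group_add \<Rightarrow> 'a) \<Rightarrow> ('a \<Rightarrow> 'a \<Rightarrow> 'a)
      \<Rightarrow> ('a \<times> 'a \<Rightarrow>\<^sub>0 'r) set \<Rightarrow> ('a \<times> 'a \<times> 'a \<Rightarrow>\<^sub>0 'r) set"
  where "AYB scale m r = induced (tensor_rel3 scale) (AYB_free m) r"

definition coboundary_eps_bialgebra ::
    "('r::comm_ring_1 \<Rightarrow> 'a::ab_group_add \<Rightarrow> 'a) \<Rightarrow> ('a \<Rightarrow> 'a \<Rightarrow> 'a)
      \<Rightarrow> ('a \<times> 'a \<Rightarrow>\<^sub>0 'r) set \<Rightarrow> bool"
  where "coboundary_eps_bialgebra scale m r \<longleftrightarrow>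
    associative_algebra scale m \<and> r \<in> tensor2 scale \<and>
    (\<forall>a. left_action scale m a (AYB scale m r) = right_action scale m a (AYB scale m r))"


section \<open>Independence of representatives\<close>

interpretation free: module "free_scale :: 'r::comm_ring_1 \<Rightarrow> ('x \<Rightarrow>\<^sub>0 'r) \<Rightarrow> _"
  by (rule module_free_scale)

lemma induced_coset:
  fixes p :: "'x \<Rightarrow>\<^sub>0 'r::comm_ring_1" and F :: "('x \<Rightarrow>\<^sub>0 'r) \<Rightarrow> ('y \<Rightarrow>\<^sub>0 'r)"
  assumes N: "free.subspace N" and N': "free.subspace N'"
    and F: "\<And>q. q - p \<in> N \<Longrightarrow> F q - F p \<in> N'"
  shows "induced N' F (p +o N) = F p +o N'"
proof -
  have "F q +o N' = F p +o N'" if "q \<in> p +o N" for q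
  proof -
    have *: "F q - F p \<in> N'" using that F by (simp add: set_minus_plus)
    have "x - F q \<in> N' \<longleftrightarrow> x - F p \<in> N'" for x
      using free.subspace_add[OF N' *, of "x - F q"] free.subspace_diff[OF N' _ *, of "x - F p"]
      by auto
    then show ?thesis by (auto simp flip: set_minus_plus)
  qed
  moreover have "p \<in> p +o N"
    using free.subspace_0[OF N] by (simp flip: set_minus_plus)
  ultimately show ?thesis
    unfolding induced_def by blast
qed

lemma induced_linear_coset:
  fixes p :: "'x \<Rightarrow>\<^sub>0 'r::comm_ring_1" and F :: "('x \<Rightarrow>\<^sub>0 'r) \<Rightarrow> ('y \<Rightarrow>\<^sub>0 'r)"
  assumes F: "module_hom free_scale free_scale F" and G: "\<And>g. g \<in> G \<Longrightarrow> F g \<in> free.span G'"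
  shows "induced (free.span G') F (p +o free.span G) = F p +o free.span G'"
proof (rule induced_coset)
  fix q assume "q - p \<in> free.span G"
  moreover have "free.span G \<subseteq> F -` free.span G'"
    by (rule free.span_minimal) (use G module_hom.subspace_vimage[OF F] in auto)
  ultimately show "F q - F p \<in> free.span G'"
    by (auto simp flip: module_hom.diff[OF F])
qed auto

lemmas free_ext_hom = module_hom_free_ext[OF module_free_scale]

lemmas free_ext_simps =
  module_hom.add[OF free_ext_hom] module_hom.diff[OF free_ext_hom]
  module_hom.scale[OF free_ext_hom] module_hom.sum[OF free_ext_hom]
  free_ext_basis[OF module_free_scale]

lemma tensor_gens3_in_rel3:
  "basis (x + x', y, z) - basis (x, y, z) - basis (x', y, z) \<in> tensor_rel3 scale"
  "basis (x, y + y', z) - basis (x, y, z) - basis (x, y', z) \<in> tensor_rel3 scale"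
  "basis (x, y, z + z') - basis (x, y, z) - basis (x, y, z') \<in> tensor_rel3 scale"
  "basis (scale c x, y, z) - free_scale c (basis (x, y, z)) \<in> tensor_rel3 scale"
  "basis (x, scale c y, z) - free_scale c (basis (x, y, z)) \<in> tensor_rel3 scale"
  "basis (x, y, scale c z) - free_scale c (basis (x, y, z)) \<in> tensor_rel3 scale"
  unfolding tensor_rel3_def tensor_gens3_def
  by - (rule free.span_base, fast)+

lemma subspace_rel3: "free.subspace (tensor_rel3 scale)"
  by (simp add: tensor_rel3_def)

lemma bilinear_productD:
  assumes "bilinear_product scale m"
  shows "m (a + a') b = m a b + m a' b" "m a (b + b') = m a b + m a b'"
    "m (scale c a) b = scale c (m a b)" "m a (scale c b) = scale c (m a b)"
  using assms by (auto simp: bilinear_product_def module_hom_iff)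

lemma left_action_coset:
  assumes "bilinear_product scale m"
  shows "left_action scale m a (p +o tensor_rel3 scale) =
    free_ext free_scale (\<lambda>(x, y, z). basis (m a x, y, z)) p +o tensor_rel3 scale"
  unfolding left_action_def
  apply (subst (1 2 3) tensor_rel3_def)
  apply (rule induced_linear_coset[OF free_ext_hom])
  apply (fold tensor_rel3_def)
  apply (auto simp: tensor_gens3_def free_ext_simps bilinear_productD[OF assms]
      intro: tensor_gens3_in_rel3)
  done

lemma right_action_coset:
  assumes "bilinear_product scale m"
  shows "right_action scale m a (p +o tensor_rel3 scale) =
    free_ext free_scale (\<lambda>(x, y, z). basis (x, y, m z a)) p +o tensor_rel3 scale"
  unfolding right_action_def
  apply (subst (1 2 3) tensor_rel3_def)
  apply (rule induced_linear_coset[OF free_ext_hom])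
  apply (fold tensor_rel3_def)
  apply (auto simp: tensor_gens3_def free_ext_simps bilinear_productD[OF assms]
      intro: tensor_gens3_in_rel3)
  done

lemma AYB_term_rel3:
  fixes scale :: "'r::comm_ring_1 \<Rightarrow> 'a::ab_group_add \<Rightarrow> 'a"
  assumes "bilinear_product scale m" "g \<in> tensor_gens2 scale"
  shows "free_ext free_scale (\<lambda>y. AYB_term m x y) g \<in> tensor_rel3 scale"
    and "free_ext free_scale (\<lambda>x. AYB_term m x y) g \<in> tensor_rel3 scale"
proof -
  note S = subspace_rel3[of scale]
  have comb: "(a - b - c) - (a' - b' - c') + (a'' - b'' - c'') \<in> tensor_rel3 scale"
    if "a - b - c \<in> tensor_rel3 scale" "a' - b' - c' \<in> tensor_rel3 scale"
      "a'' - b'' - c'' \<in> tensor_rel3 scale" for a b c a' b' c' a'' b'' c''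
    by (intro free.subspace_add[OF S] free.subspace_diff[OF S] that)
  have comb2: "(a - b) - (a' - b') + (a'' - b'') \<in> tensor_rel3 scale"
    if "a - b \<in> tensor_rel3 scale" "a' - b' \<in> tensor_rel3 scale"
      "a'' - b'' \<in> tensor_rel3 scale" for a b a' b' a'' b''
    by (intro free.subspace_add[OF S] free.subspace_diff[OF S] that)
  have r1: "(a - a' + a'') - (b - b' + b'') - (c - c' + c'') =
      (a - b - c) - (a' - b' - c') + (a'' - b'' - c'')"
    for a b c a' b' c' a'' b'' c'' :: "'a \<times> 'a \<times> 'a \<Rightarrow>\<^sub>0 'r" by simp
  have r2: "(a - a' + a'') - free_scale k (b - b' + b'') =
      (a - free_scale k b) - (a' - free_scale k b') + (a'' - free_scale k b'')"
    for k and a b a' b' a'' b'' :: "'a \<times> 'a \<times> 'a \<Rightarrow>\<^sub>0 'r" by (simp add: algebra_simps)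
  show "free_ext free_scale (\<lambda>y. AYB_term m x y) g \<in> tensor_rel3 scale"
    using assms(2) unfolding tensor_gens2_def
    by (cases x) (auto simp only: free_ext_simps AYB_term_def prod.case r1 r2
        bilinear_productD[OF assms(1)] intro!: comb comb2 tensor_gens3_in_rel3)
  show "free_ext free_scale (\<lambda>x. AYB_term m x y) g \<in> tensor_rel3 scale"
    using assms(2) unfolding tensor_gens2_def
    by (cases y) (auto simp only: free_ext_simps AYB_term_def prod.case r1 r2
        bilinear_productD[OF assms(1)] intro!: comb comb2 tensor_gens3_in_rel3)
qed

lemma free_ext_swap:
  "free_ext free_scale (\<lambda>x. free_ext free_scale (\<lambda>y. T x y) q) p =
   free_ext free_scale (\<lambda>y. free_ext free_scale (\<lambda>x. T x y) p) q"
  unfolding free_ext_def free.scale_sum_right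
  by (subst sum.swap) (simp add: mult.commute)

lemma free_ext_in_subspace:
  "free.subspace N \<Longrightarrow> (\<And>x. f x \<in> N) \<Longrightarrow> free_ext free_scale f p \<in> N"
  unfolding free_ext_def by (intro free.subspace_sum free.subspace_scale)

lemma AYB_coset:
  fixes scale :: "'r::comm_ring_1 \<Rightarrow> 'a::ab_group_add \<Rightarrow> 'a"
  assumes m: "bilinear_product scale m"
  shows "AYB scale m (p +o tensor_rel2 scale) = AYB_free m p +o tensor_rel3 scale"
  unfolding AYB_def
proof (rule induced_coset)
  show "free.subspace (tensor_rel2 scale)" by (simp add: tensor_rel2_def)
  show "free.subspace (tensor_rel3 scale)" by (rule subspace_rel3)
  fix q assume "q - p \<in> tensor_rel2 scale"
  define B :: "('a \<times> 'a \<Rightarrow>\<^sub>0 'r) \<Rightarrow> ('a \<times> 'a \<Rightarrow>\<^sub>0 'r) \<Rightarrow> _" where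
    "B = (\<lambda>p q. free_ext free_scale (\<lambda>x. free_ext free_scale (\<lambda>y. AYB_term m x y) q) p)"
  have B': "B p q = free_ext free_scale (\<lambda>y. free_ext free_scale (\<lambda>x. AYB_term m x y) p) q"
    for p q unfolding B_def by (rule free_ext_swap)
  have sub: "tensor_rel2 scale \<subseteq> free_ext free_scale T -` tensor_rel3 scale"
    if "\<And>g. g \<in> tensor_gens2 scale \<Longrightarrow> free_ext free_scale T g \<in> tensor_rel3 scale" for T
    unfolding tensor_rel2_def
    by (rule free.span_minimal)
       (use that in \<open>auto intro: module_hom.subspace_vimage[OF free_ext_hom subspace_rel3]\<close>)
  have *: "free_ext free_scale (\<lambda>y. AYB_term m x y) (q - p) \<in> tensor_rel3 scale"
    "free_ext free_scale (\<lambda>x. AYB_term m x y) (q - p) \<in> tensor_rel3 scale" for x y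
    using subsetD[OF sub[OF AYB_term_rel3(1)[OF m]] \<open>q - p \<in> _\<close>]
      subsetD[OF sub[OF AYB_term_rel3(2)[OF m]] \<open>q - p \<in> _\<close>] by auto
  have "AYB_free m q - AYB_free m p = B q q - B p p"
    by (simp add: AYB_free_def B_def)
  also have "\<dots> = B (q - p) q + B p (q - p)"
  proof -
    have "B (q - p) q = B q q - B p q"
      unfolding B_def by (rule module_hom.diff[OF free_ext_hom])
    moreover have "B p (q - p) = B p q - B p p"
      unfolding B' by (rule module_hom.diff[OF free_ext_hom])
    ultimately show ?thesis by simp
  qed
  also have "\<dots> \<in> tensor_rel3 scale"
  proof (rule free.subspace_add[OF subspace_rel3])
    show "B (q - p) q \<in> tensor_rel3 scale"
      unfolding B' by (rule free_ext_in_subspace[OF subspace_rel3]) (rule *)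
    show "B p (q - p) \<in> tensor_rel3 scale"
      unfolding B_def by (rule free_ext_in_subspace[OF subspace_rel3]) (rule *)
  qed
  finally show "AYB_free m q - AYB_free m p \<in> tensor_rel3 scale" .
qed

lemma AYB_sum:
  assumes "bilinear_product scale m"
  shows "AYB scale m ((\<Sum>i\<in>I. basis (u i, v i)) +o tensor_rel2 scale) =
    (\<Sum>i\<in>I. \<Sum>j\<in>I. basis (m (u i) (u j), v j, v i) - basis (u i, m (v i) (u j), v j)
        + basis (u j, u i, m (v i) (v j))) +o tensor_rel3 scale"
  unfolding AYB_coset[OF assms] AYB_free_def
  by (simp add: free_ext_simps AYB_term_def)

end

theory Submission
  imports Defs
begin

text \<open>
  The contraction \<open>x \<otimes> y \<otimes> z \<mapsto> xaybz\<close> sends \<open>AYB(r)\<close> to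
  \<open>w = \<RR>(a\<RR>(b) + \<RR>(a)b) - \<RR>(a)\<RR>(b)\<close>, and it turns the two actions of \<open>c\<close> on the outer tensor
  factors into left and right multiplication by \<open>c\<close>. Invariance of \<open>AYB(r)\<close> therefore says that
  \<open>cw = wc\<close>. In the \<open>A\<^sub>3\<close>-dendriform identity the terms \<open>\<RR>(b)c\<RR>(a)\<close> cancel by associativity, and
  what is left is again \<open>cw = wc\<close>.
\<close>

lemma bilinear_product_sum:
  assumes "bilinear_product scale m"
  shows "m (sum f I) b = (\<Sum>i\<in>I. m (f i) b)" "m a (sum f I) = (\<Sum>i\<in>I. m a (f i))"
  using assms module_hom.sum[of scale scale "\<lambda>x. m x b"] module_hom.sum[of scale scale "m a"]
  by (auto simp: bilinear_product_def)

lemma bilinear_product_diff: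
  fixes m :: "'a::ab_group_add \<Rightarrow> 'a \<Rightarrow> 'a"
  assumes "bilinear_product scale m"
  shows "m (a - a') b = m a b - m a' b" "m a (b - b') = m a b - m a b'"
  using assms module_hom.diff[of scale scale "\<lambda>x. m x b"] module_hom.diff[of scale scale "m a"]
  by (auto simp: bilinear_product_def)

lemma module_hom_bilinear_product_left:
  "bilinear_product scale m \<Longrightarrow> module_hom scale scale (\<lambda>b. m a b)"
  by (simp add: bilinear_product_def)

lemma module_hom_bilinear_product_right:
  "bilinear_product scale m \<Longrightarrow> module_hom scale scale (\<lambda>a. m a b)"
  by (simp add: bilinear_product_def)

text \<open>Gives bilinearity of \<open>prec\<close> and \<open>succ\<close>, each of which is the
  product with one argument passed through the linear map \<open>R\<close>.\<close>

lemma bilinear_product_comp: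
  assumes m: "bilinear_product scale m" and f: "module_hom scale scale f"
  shows "bilinear_product scale (\<lambda>a b. m (f a) b)" "bilinear_product scale (\<lambda>a b. m a (f b))"
  using module_hom_bilinear_product_left[OF m] module_hom_bilinear_product_right[OF m]
    module_hom_compose[OF f] f
  by (auto simp: bilinear_product_def o_def)

text \<open>One half of the universal property of the triple tensor product: a linear extension that
  kills the generating relations kills their span, so it descends to the quotient.\<close>

lemma free_ext_rel3_eq_0:
  assumes s: "module s"
    and gens: "\<And>g. g \<in> tensor_gens3 s \<Longrightarrow> free_ext s f g = 0"
    and p: "p \<in> tensor_rel3 s"
  shows "free_ext s f p = 0"
  by (rule module_hom.eq_0_on_span[OF module_hom_free_ext[OF s]])
     (use gens p in \<open>auto simp: tensor_rel3_def\<close>)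

lemma rel3_coset_eqD:
  fixes p q :: "'a::ab_group_add \<times> 'a \<times> 'a \<Rightarrow>\<^sub>0 'r::comm_ring_1"
  assumes "p +o tensor_rel3 scale = q +o tensor_rel3 scale"
  shows "p - q \<in> tensor_rel3 scale"
proof -
  have "p \<in> p +o tensor_rel3 scale"
    using free.subspace_0[OF subspace_rel3] by (simp flip: set_minus_plus)
  then show ?thesis
    using assms by (simp add: set_minus_plus)
qed

text \<open>Invariance is an equality of cosets. The contraction is therefore applied to the
  difference of two representatives, a relation, which it sends to 0.\<close>

lemma AYB_contraction_commutes:
  fixes scale :: "'r::comm_ring_1 \<Rightarrow> 'a::ab_group_add \<Rightarrow> 'a"
  assumes cob: "coboundary_eps_bialgebra scale m ((\<Sum>i\<in>I. basis (u i, v i)) +o tensor_rel2 scale)"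
    and R: "\<And>a. R a = (\<Sum>i\<in>I. m (m (u i) a) (v i))"
  defines "w a b \<equiv> R (m a (R b) + m (R a) b) - m (R a) (R b)"
  shows "m (w a b) c = m c (w a b)"
proof -
  from cob have M: "module scale" and m: "bilinear_product scale m"
    and assoc: "m (m x y) z = m x (m y z)" for x y z
    by (auto simp: coboundary_eps_bialgebra_def associative_algebra_def)
  note bil = bilinear_productD[OF m]
  \<comment> \<open>The contraction, nested to the right because that is the normal form under
    rewriting with \<open>assoc\<close>.\<close>
  define T where "T = (\<lambda>(x, y, z). m x (m a (m y (m b z))))"
  define t :: "'a \<times> 'a \<times> 'a \<Rightarrow>\<^sub>0 'r" where
    "t = (\<Sum>i\<in>I. \<Sum>j\<in>I. basis (m (u i) (u j), v j, v i) - basis (u i, m (v i) (u j), v j)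
        + basis (u j, u i, m (v i) (v j)))"
  define L where "L = (\<lambda>(x, y, z). basis (m c x, y, z) :: 'a \<times> 'a \<times> 'a \<Rightarrow>\<^sub>0 'r)"
  define K where "K = (\<lambda>(x, y, z). basis (x, y, m z c) :: 'a \<times> 'a \<times> 'a \<Rightarrow>\<^sub>0 'r)"
  note hom = module_hom_free_ext[OF M]
  note ext = module_hom.add[OF hom] module_hom.diff[OF hom] module_hom.scale[OF hom]
    module_hom.sum[OF hom] free_ext_basis[OF M]
  note sums = bilinear_product_sum[OF m]
  have "free_ext free_scale L t +o tensor_rel3 scale = free_ext free_scale K t +o tensor_rel3 scale"
    using cob unfolding coboundary_eps_bialgebra_def
    by (simp add: AYB_sum[OF m] left_action_coset[OF m] right_action_coset[OF m] t_def L_def K_def)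
  then have "free_ext free_scale L t - free_ext free_scale K t \<in> tensor_rel3 scale"
    by (rule rel3_coset_eqD)
  \<comment> \<open>\<open>T\<close> is trilinear, so each generator cancels.\<close>
  moreover have "free_ext scale T g = 0" if "g \<in> tensor_gens3 scale" for g
    using that unfolding tensor_gens3_def by (auto simp: ext T_def bil)
  ultimately have "free_ext scale T (free_ext free_scale L t - free_ext free_scale K t) = 0"
    using free_ext_rel3_eq_0[OF M] by blast
  then have eq: "free_ext scale T (free_ext free_scale L t) = free_ext scale T (free_ext free_scale K t)"
    by (simp add: ext)
  \<comment> \<open>The three summands of \<open>AYB\<close> contract, in this order, to
    \<open>R (m (R a) b)\<close>, \<open>m (R a) (R b)\<close> and
    \<open>R (m a (R b))\<close>.\<close>
  have w: "w a b = (\<Sum>i\<in>I. \<Sum>j\<in>I. T (m (u i) (u j), v j, v i) - T (u i, m (v i) (u j), v j)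
        + T (u j, u i, m (v i) (v j)))"
  proof -
    have "R (m (R a) b) = (\<Sum>i\<in>I. \<Sum>j\<in>I. T (m (u i) (u j), v j, v i))"
      by (simp add: R T_def sums assoc)
    moreover have "m (R a) (R b) = (\<Sum>i\<in>I. \<Sum>j\<in>I. T (u i, m (v i) (u j), v j))"
      unfolding R sums by (subst sum.swap) (simp add: T_def assoc)
    \<comment> \<open>Here the outer \<open>R\<close> carries the index \<open>j\<close> of the
      inner sum, hence the exchange of sums.\<close>
    moreover have "R (m a (R b)) = (\<Sum>i\<in>I. \<Sum>j\<in>I. T (u j, u i, m (v i) (v j)))"
      by (subst sum.swap) (simp add: R T_def sums assoc)
    moreover have "R (x + y) = R x + R y" for x y
      by (simp add: R bil sum.distrib)
    ultimately show ?thesis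
      by (simp add: w_def sum.distrib sum_subtractf)
  qed
  have "free_ext scale T (free_ext free_scale L t) = m c (w a b)"
    unfolding w t_def
    by (simp add: ext free_ext_simps L_def sums bil bilinear_product_diff[OF m] T_def assoc)
  moreover have "free_ext scale T (free_ext free_scale K t) = m (w a b) c"
    unfolding w t_def
    by (simp add: ext free_ext_simps K_def sums bil bilinear_product_diff[OF m] T_def assoc)
  ultimately show ?thesis
    using eq by simp
qed

theorem proposition3p16:
  fixes scale :: "'r::comm_ring_1 \<Rightarrow> 'a::ab_group_add \<Rightarrow> 'a"
    and \<mu> :: "'a \<Rightarrow> 'a \<Rightarrow> 'a"
    and r :: "('a \<times> 'a \<Rightarrow>\<^sub>0 'r) set"
    and n :: nat
    and u v :: "nat \<Rightarrow> 'a"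
    and \<RR> :: "'a \<Rightarrow> 'a"
    and prec succ :: "'a \<Rightarrow> 'a \<Rightarrow> 'a"
  assumes two_invertible: "(2::'r) dvd 1"
    and coboundary: "coboundary_eps_bialgebra scale \<mu> r"
    and r: "r = (\<Sum>i<n. basis (u i, v i)) +o tensor_rel2 scale"
    and \<RR>: "\<And>a. \<RR> a = (\<Sum>i<n. \<mu> (\<mu> (u i) a) (v i))"
    and succ: "\<And>a b. succ a b = \<mu> (\<RR> a) b"
    and prec: "\<And>a b. prec a b = \<mu> a (\<RR> b)"
  shows "weak_rota_baxter scale \<mu> \<RR> \<and>
    (\<forall>a b. succ a b = (\<Sum>i<n. \<mu> (\<mu> (\<mu> (u i) a) (v i)) b) \<and>
           prec a b = (\<Sum>i<n. \<mu> (\<mu> (\<mu> a (u i)) b) (v i))) \<and>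
    A3_dendriform scale prec succ \<and> inner_associative prec succ"
proof -
  from coboundary have M: "module scale" and m: "bilinear_product scale \<mu>"
    and assoc: "\<mu> (\<mu> x y) z = \<mu> x (\<mu> y z)" for x y z
    by (auto simp: coboundary_eps_bialgebra_def associative_algebra_def)
  note bil = bilinear_productD[OF m] and sums = bilinear_product_sum[OF m]
    and diff = bilinear_product_diff[OF m]
  have hom: "module_hom scale scale \<RR>"
    by (simp add: module_hom_iff M \<RR> bil sum.distrib module.scale_sum_right[OF M])
  have comm: "\<mu> (\<RR> (\<mu> a (\<RR> b) + \<mu> (\<RR> a) b) - \<mu> (\<RR> a) (\<RR> b)) c =
      \<mu> c (\<RR> (\<mu> a (\<RR> b) + \<mu> (\<RR> a) b) - \<mu> (\<RR> a) (\<RR> b))" for a b c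
    by (rule AYB_contraction_commutes[OF coboundary[unfolded r] \<RR>])
  have "weak_rota_baxter scale \<mu> \<RR>"
    unfolding weak_rota_baxter_def Let_def using hom comm by blast
  \<comment> \<open>For \<open>prec\<close>, associativity is needed to move \<open>a\<close> inside
    the brackets.\<close>
  moreover have "succ a b = (\<Sum>i<n. \<mu> (\<mu> (\<mu> (u i) a) (v i)) b) \<and>
      prec a b = (\<Sum>i<n. \<mu> (\<mu> (\<mu> a (u i)) b) (v i))" for a b
    by (simp add: succ prec \<RR> sums assoc)
  moreover have "A3_dendriform scale prec succ"
  proof -
    have "prec = (\<lambda>a b. \<mu> a (\<RR> b))" "succ = (\<lambda>a b. \<mu> (\<RR> a) b)"
      by (simp_all add: fun_eq_iff prec succ)
    then have "bilinear_product scale prec" "bilinear_product scale succ"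
      using bilinear_product_comp[OF m hom] by simp_all
    \<comment> \<open>The sum \<open>prec a b + succ a b\<close> is exactly the argument of the
      outer \<RR> in \<open>comm\<close>.\<close>
    moreover have "succ a (succ b c) - prec (prec c a) b + prec c (prec a b + succ a b) =
        succ (prec a b + succ a b) c - succ b (prec c a) + prec (succ b c) a" for a b c
      using comm[of a b c] by (simp add: prec succ diff assoc algebra_simps)
    ultimately show ?thesis
      by (simp add: A3_dendriform_def Let_def M)
  qed
  \<comment> \<open>Both sides are \<RR>(a)b\<RR>(c).\<close>
  moreover have "inner_associative prec succ"
    by (simp add: inner_associative_def prec succ assoc)
  ultimately show ?thesis
    by blast
qed

end
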